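(* Let $1\le k\le n-1$ be integers and let $\Delta(k)=\{x\in[0,1]^n : \sum_{i=1}^n x_i=k\}\subseteq\mathbb{R}^n$ be the $k$-hypersimplex. Then the simple extension complexity of $\Delta(k)$ is equal to its number of vertices $\binom{n}{k}$.
   Context: An extension of a polytope $P$ is a polytope $Q$ together with a linear map $\pi$ (a projection) with $\pi(Q)=P$. The size of a polytope is its number of facets. A $d$-dimensional polytope is simple if every vertex is contained in exactly $d$ facets. The simple extension complexity $\operatorname{sxc}(P)$ is the smallest size of any simple polytope $Q$ that is an extension of $P$. *)

theory Defs
  imports "HOL-Analysis.Analysis" "HOL-Analysis.Finite_Function_Topology"
begin

text \<open>
  An extension may live in a space \<open>\<real>\<^sup>m\<close> of any dimension \<open>m\<close>, so \<open>m\<close> has to be a term and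
  \<open>\<real>\<^sup>m\<close> cannot be \<^typ>\<open>real ^ 'm\<close>. It is taken to be the subspace of those finitely supported
  sequences whose entries with index at least \<open>m\<close> vanish.
\<close>

definition Rspace :: "nat \<Rightarrow> (nat \<Rightarrow>\<^sub>0 real) set" where
  "Rspace m = {x. Poly_Mapping.keys x \<subseteq> {..<m}}"

text \<open>
  \<^const>\<open>aff_dim\<close> and \<^const>\<open>facet_of\<close> are restricted to class \<^class>\<open>euclidean_space\<close>, to which
  \<^typ>\<open>nat \<Rightarrow>\<^sub>0 real\<close> does not belong. The next two definitions repeat the library's
  for arbitrary real vector spaces; they are only meaningful for sets of finite affine dimension,
  such as polytopes.
\<close>

definition affine_dim :: "'a::real_vector set \<Rightarrow> int" where
  "affine_dim V =
    (SOME d :: int.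
      \<exists>B. affine hull B = affine hull V \<and> \<not> affine_dependent B \<and> of_nat (card B) = d + 1)"

definition facets :: "'a::real_vector set \<Rightarrow> 'a set set" where
  "facets P = {F. F face_of P \<and> F \<noteq> {} \<and> affine_dim F = affine_dim P - 1}"

lemma affine_dim_eq_aff_dim: "affine_dim (V :: 'a::euclidean_space set) = aff_dim V"
  by (simp add: affine_dim_def aff_dim_def)

lemma facets_eq: "facets (P :: 'a::euclidean_space set) = {F. F facet_of P}"
  by (simp add: facets_def facet_of_def affine_dim_eq_aff_dim)

definition simple_polytope :: "'a::real_vector set \<Rightarrow> bool" where
  "simple_polytope P \<longleftrightarrow> polytope P \<and>
     (\<forall>v. v extreme_point_of P \<longrightarrow> int (card {F \<in> facets P. v \<in> F}) = affine_dim P)"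

definition extension :: "'a::real_vector set \<Rightarrow> ('a \<Rightarrow> 'b::real_vector) \<Rightarrow> 'b set \<Rightarrow> bool" where
  "extension Q \<pi> P \<longleftrightarrow> polytope Q \<and> linear \<pi> \<and> \<pi> ` Q = P"

text \<open>
  Every linear map on \<^term>\<open>Rspace m\<close> is the restriction of a linear map on the whole type, so it
  does no harm that \<open>\<pi>\<close> is defined on all of \<^typ>\<open>nat \<Rightarrow>\<^sub>0 real\<close>.
\<close>

definition sxc :: "'b::real_vector set \<Rightarrow> nat" where
  "sxc P = (LEAST s. \<exists>m Q \<pi>. Q \<subseteq> Rspace m \<and> simple_polytope Q \<and> extension Q \<pi> P \<and>
                               card (facets Q) = s)"

definition hypersimplex :: "nat \<Rightarrow> (real ^ 'n) set" where
  "hypersimplex k = {x. (\<forall>i. 0 \<le> x $ i \<and> x $ i \<le> 1) \<and> (\<Sum>i\<in>UNIV. x $ i) = real k}"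

end

theory Submission
  imports Defs
begin

text \<open>
  \<^bold>\<open>Upper bound.\<close> A polytope with \<open>N\<close> vertices is a linear image of the simplex whose vertices are \<open>N\<close>
  unit vectors, and for \<open>N \<ge> 2\<close> that simplex is simple with \<open>N\<close> facets
  (\<open>hypersimplex_simple_extension_by_simplex\<close>).

  \<^bold>\<open>Lower bound.\<close> Let \<open>p\<close> map a simple polytope \<open>Q\<close> onto the hypersimplex. The preimage in \<open>Q\<close> of a face
  is a face. Write \<open>G A\<close> for the fibre over the vertex with support \<open>A\<close>, where \<open>card A = k\<close>. Simplicity
  enters through \<open>simple_polytope_facet_contains_one_face\<close>: if a facet \<open>f\<close> contains the nonempty
  intersection of two faces, then it contains one of the two. Apply this to the preimages of the two
  smallest faces of the hypersimplex that contain the vertices \<open>C, A\<close> and \<open>C, B\<close>. They intersect only in the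
  vertex \<open>C\<close> as soon as \<open>C \<subseteq> A \<union> B\<close> or \<open>A \<inter> B \<subseteq> C\<close>. Hence, if \<open>f\<close> contains neither \<open>G A\<close> nor \<open>G B\<close>,
  it does not contain \<open>G C\<close> for any such \<open>C\<close>. A family of \<open>k\<close>-sets that is closed in this sense and has two
  members contains all \<open>k\<close>-sets (\<open>closed_family_is_everything\<close>), so the fibres that a facet does not
  contain are either all of them, or at most one.

  On the other hand \<open>G C\<close> is the intersection of the facets containing it, so for \<open>A \<noteq> C\<close> (such a \<open>C\<close> exists as
  \<open>1 \<le> k < n\<close>) some facet contains \<open>G C\<close> but not \<open>G A\<close>; by the dichotomy \<open>G A\<close> is then the
  only fibre that it does not contain. Different sets \<open>A\<close> get different facets, and \<open>Q\<close> has at least as many facets as there are \<open>k\<close>-sets.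

  \<^bold>\<open>Dimension.\<close> The inequalities that describe facets are stated with the inner product of a Euclidean space,
  whose dimension is fixed by its type, whereas \<open>Q\<close> lies in a space of arbitrary dimension. But a vertex of a simple polytope lies in
  \<open>dim Q\<close> facets, so a simple extension with fewer facets than there are \<open>k\<close>-subsets of an \<open>n\<close>-set has
  linear span of dimension at most \<open>2 ^ n\<close> and embeds into \<open>\<real>\<close> to the power set of the
  index set. The embedding has a linear left inverse on \<open>Q\<close>, and everything in the definition
  of a simple polytope is preserved (\<open>simple_polytope_linear_image\<close>).
\<close>

section \<open>Polytopes in arbitrary real vector spaces\<close>

lemma extreme_point_no_symmetric_translate:
  assumes "v extreme_point_of Q" "v + r \<in> Q" "v - r \<in> Q"
  shows "r = 0"
proof (rule ccontr)
  assume "r \<noteq> 0"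
  have "v + r \<noteq> v - r"
  proof
    assume "v + r = v - r"
    then have "2 *\<^sub>R r = 0" by (simp add: scaleR_2 eq_neg_iff_add_eq_0)
    then show False using \<open>r \<noteq> 0\<close> by simp
  qed
  moreover have "v = (1 - 1/2) *\<^sub>R (v + r) + (1/2) *\<^sub>R (v - r)"
    by (simp add: algebra_simps flip: scaleR_left_distrib)
  ultimately have "v \<in> open_segment (v + r) (v - r)"
    unfolding in_segment by (intro conjI exI[of _ "1/2"]) auto
  then show False using assms unfolding extreme_point_of_def by blast
qed

text \<open>
  The points of the hull that satisfy \<open>x \<in> T \<longrightarrow> x \<in> convex hull (S \<inter> T)\<close> form a convex set, because an
  inner point of a segment can lie in \<open>T\<close> only if both end points do; this set contains \<open>S\<close>. The argument needs no
  topology, and so is available outside Euclidean spaces.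
\<close>
lemma face_of_convex_hull_eq:
  fixes S :: "'a::real_vector set"
  assumes T: "T face_of convex hull S"
  shows "T = convex hull (S \<inter> T)"
proof
  let ?C = "{x \<in> convex hull S. x \<in> T \<longrightarrow> x \<in> convex hull (S \<inter> T)}"
  have "convex ?C"
  proof (subst convex_contains_open_segment, intro ballI subsetI)
    fix x y z assume x: "x \<in> ?C" and y: "y \<in> ?C" and z: "z \<in> open_segment x y"
    have "open_segment x y \<subseteq> convex hull S"
      using x y convex_convex_hull[of S] unfolding convex_contains_open_segment by blast
    moreover have "z \<in> convex hull (S \<inter> T)" if "z \<in> T"
    proof -
      have "x \<in> T" "y \<in> T"
        using T x y z that unfolding face_of_def by blast+
      then have "x \<in> convex hull (S \<inter> T)" "y \<in> convex hull (S \<inter> T)" using x y by auto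
      then show ?thesis
        using z convex_convex_hull[of "S \<inter> T"] unfolding convex_contains_open_segment by blast
    qed
    ultimately show "z \<in> ?C" using z by blast
  qed
  moreover have "S \<subseteq> ?C" by (auto simp: hull_inc)
  ultimately have "convex hull S \<subseteq> ?C" by (rule hull_minimal[rotated])
  then show "T \<subseteq> convex hull (S \<inter> T)" using face_of_imp_subset[OF T] by blast
  show "convex hull (S \<inter> T) \<subseteq> T"
    by (rule hull_minimal) (use face_of_imp_convex[OF T] in auto)
qed

lemma finite_faces_of_polytope:
  fixes Q :: "'a::real_vector set"
  assumes "polytope Q"
  shows "finite {F. F face_of Q}"
proof -
  obtain S where S: "finite S" "Q = convex hull S"
    using assms unfolding polytope_def by blast
  have "{F. F face_of Q} \<subseteq> (\<lambda>T. convex hull T) ` Pow S"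
    using face_of_convex_hull_eq unfolding S(2) by blast
  then show ?thesis using S(1) by (meson finite_Pow_iff finite_imageI finite_subset)
qed

lemma finite_facets:
  fixes Q :: "'a::real_vector set"
  assumes "polytope Q"
  shows "finite (facets Q)"
  using finite_faces_of_polytope[OF assms] unfolding facets_def by (rule rev_finite_subset) auto

text \<open>
  In a generating set of least cardinality, no point lies in the convex hull of the others.
\<close>
lemma polytope_extreme_point_exists:
  fixes Q :: "'a::real_vector set"
  assumes "polytope Q" "Q \<noteq> {}"
  obtains v where "v extreme_point_of Q"
proof -
  let ?gen = "\<lambda>S. finite S \<and> Q = convex hull S"
  obtain S where S: "?gen S" and min: "\<And>T. ?gen T \<Longrightarrow> card S \<le> card T"
    using ex_has_least_nat[of ?gen _ card] assms(1) unfolding polytope_def by blast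
  obtain a where a: "a \<in> S" using S assms(2) by fastforce
  have "a \<notin> convex hull (S - {a})"
  proof
    assume "a \<in> convex hull (S - {a})"
    \<comment> \<open>then \<open>S - {a}\<close> would be a smaller generating set\<close>
    then have "convex hull (S - {a}) = Q"
      using S a hull_redundant[of a convex "S - {a}"] by (simp add: insert_absorb)
    then have "card S \<le> card (S - {a})" using min S by simp
    then show False using S a by (metis card_Diff1_less leD)
  qed
  then have "a extreme_point_of Q"
    using extreme_point_of_convex_hull_insert[of "S - {a}" a] S a by (simp add: insert_absorb)
  then show thesis by (rule that)
qed

lemma face_of_linear_preimage:
  assumes "linear p" "p ` Q \<subseteq> P" "convex Q" "T face_of P"
  shows "Q \<inter> p -` T face_of Q"
  unfolding face_of_def
proof (intro conjI ballI impI)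
  show "convex (Q \<inter> p -` T)"
    using assms face_of_imp_convex by (intro convex_Int convex_linear_vimage) auto
  fix a b x
  assume ab: "a \<in> Q" "b \<in> Q" and x: "x \<in> Q \<inter> p -` T" "x \<in> open_segment a b"
  obtain u where u: "0 < u" "u < 1" "x = (1 - u) *\<^sub>R a + u *\<^sub>R b"
    using x(2) by (auto simp: in_segment)
  have px: "p x = (1 - u) *\<^sub>R p a + u *\<^sub>R p b"
    using u(3) assms(1) by (simp add: linear_add linear_scale)
  have "p a \<in> T \<and> p b \<in> T"
  proof (cases "p a = p b")
    case True
    then show ?thesis using px x(1) by (simp flip: scaleR_left_distrib)
  next
    case False
    then have "p x \<in> open_segment (p a) (p b)" using px u by (auto simp: in_segment)
    then show ?thesis using assms ab x(1) unfolding face_of_def by blast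
  qed
  then show "a \<in> Q \<inter> p -` T" "b \<in> Q \<inter> p -` T" using ab by auto
qed auto

section \<open>Linear maps that are injective on a polytope\<close>

lemma affine_hull_image_linear:
  assumes f: "linear f"
  shows "affine hull (f ` S) = f ` (affine hull S)"
proof
  have "affine (f ` (affine hull S))"
    using affine_affine_hull[of S] f unfolding affine_def
    by (auto simp flip: linear_add[OF f] linear_scale[OF f])
  then show "affine hull (f ` S) \<subseteq> f ` (affine hull S)"
    by (intro hull_minimal image_mono hull_subset)
  have "affine (f -` (affine hull (f ` S)))"
    using affine_affine_hull[of "f ` S"] unfolding affine_def
    by (auto simp: linear_add[OF f] linear_scale[OF f])
  then have "affine hull S \<subseteq> f -` (affine hull (f ` S))"
    by (intro hull_minimal) (auto simp: hull_inc)
  then show "f ` (affine hull S) \<subseteq> affine hull (f ` S)" by blast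
qed

text \<open>
  Injectivity of a linear map \<open>f\<close> on a set \<open>S\<close> and its span is expressed by a linear left inverse \<open>g\<close> on \<open>S\<close>.
  The hypotheses then also hold with \<open>g, f, f ` S\<close> for \<open>f, g, S\<close>, so that each inclusion
  or implication below gives its converse.
\<close>
lemma linear_inverse_on_span:
  assumes "linear f" "linear g" "\<And>x. x \<in> S \<Longrightarrow> g (f x) = x" "x \<in> span S"
  shows "g (f x) = x"
  using linear_eq_on[of "g \<circ> f" id x S] assms linear_compose[of f g]
  by (simp add: linear_id)

lemma affine_independent_linear_image:
  assumes "linear f" "linear g" and inv: "\<And>x. x \<in> B \<Longrightarrow> g (f x) = x"
    and "\<not> affine_dependent B"
  shows "\<not> affine_dependent (f ` B)"
proof
  assume "affine_dependent (f ` B)"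
  then obtain x where x: "x \<in> B" "f x \<in> affine hull (f ` B - {f x})"
    unfolding affine_dependent_def by blast
  have "inj_on f B" using inv by (metis inj_onI)
  then have "f ` B - {f x} = f ` (B - {x})" using x(1) by (auto dest: inj_onD)
  then have "g (f x) \<in> affine hull (g ` f ` (B - {x}))"
    using x(2) affine_hull_image_linear[OF assms(2)] by simp
  moreover have "g ` f ` (B - {x}) = B - {x}" using inv by force
  ultimately have "x \<in> affine hull (B - {x})" using inv x(1) by simp
  then show False using assms(4) x(1) unfolding affine_dependent_def by blast
qed

lemma affine_basis_linear_image:
  assumes "linear f" "linear g" and inv: "\<And>x. x \<in> S \<Longrightarrow> g (f x) = x"
    and B: "affine hull B = affine hull S" "\<not> affine_dependent B"
  shows "affine hull (f ` B) = affine hull (f ` S) \<and> \<not> affine_dependent (f ` B)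
    \<and> card (f ` B) = card B"
proof -
  have "B \<subseteq> span S"
    using B(1) hull_subset[of B affine] affine_hull_subset_span[of S] by blast
  then have invB: "\<And>x. x \<in> B \<Longrightarrow> g (f x) = x"
    using linear_inverse_on_span[OF assms(1-3)] by blast
  then have "inj_on f B" by (metis inj_onI)
  then show ?thesis
    using affine_independent_linear_image[OF assms(1,2) invB B(2)] B(1)
    by (simp add: affine_hull_image_linear[OF assms(1)] card_image)
qed

lemma affine_dim_linear_image:
  assumes "linear f" "linear g" and inv: "\<And>x. x \<in> S \<Longrightarrow> g (f x) = x"
  shows "affine_dim (f ` S) = affine_dim S"
proof -
  let ?B = "\<lambda>S (d::int) B. affine hull B = affine hull S \<and> \<not> affine_dependent B \<and> of_nat (card B) = d + 1"
  have gf: "g ` f ` S = S" using inv by force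
  have inv': "\<And>y. y \<in> f ` S \<Longrightarrow> f (g y) = y" using inv by auto
  have "(\<exists>B. ?B (f ` S) d B) \<longleftrightarrow> (\<exists>B. ?B S d B)" for d
  proof
    assume "\<exists>B. ?B S d B"
    then obtain B where B: "affine hull B = affine hull S" "\<not> affine_dependent B"
      "of_nat (card B) = d + 1" by blast
    have "?B (f ` S) d (f ` B)"
      using affine_basis_linear_image[OF assms B(1,2)] B(3) by metis
    then show "\<exists>B. ?B (f ` S) d B" by blast
  next
    assume "\<exists>B. ?B (f ` S) d B"
    then obtain B where B: "affine hull B = affine hull (f ` S)" "\<not> affine_dependent B"
      "of_nat (card B) = d + 1" by blast
    have "?B S d (g ` B)"
      using affine_basis_linear_image[OF assms(2,1) inv' B(1,2)] B(3) gf by metis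
    then show "\<exists>B. ?B S d B" by blast
  qed
  then show ?thesis unfolding affine_dim_def by simp
qed

text \<open>
  On \<open>f ` S\<close>, the image of \<open>T\<close> is the preimage of \<open>T\<close> under \<open>g\<close>.
\<close>
lemma face_of_linear_image_on:
  assumes "linear f" "linear g" and inv: "\<And>x. x \<in> S \<Longrightarrow> g (f x) = x"
    and T: "T face_of S" and "convex S"
  shows "f ` T face_of f ` S"
proof -
  have "g ` f ` S \<subseteq> S" using inv by auto
  then have "f ` S \<inter> g -` T face_of f ` S"
    using face_of_linear_preimage[OF assms(2) _ convex_linear_image T] assms by blast
  moreover have "f ` S \<inter> g -` T = f ` T"
    using inv face_of_imp_subset[OF T] by force
  ultimately show ?thesis by simp
qed

lemma facets_linear_image:
  assumes "linear f" "linear g" and inv: "\<And>x. x \<in> S \<Longrightarrow> g (f x) = x" and "convex S"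
  shows "facets (f ` S) = (`) f ` facets S"
proof -
  have sub: "(`) f ` facets S \<subseteq> facets (f ` S)"
    if "linear f" "linear g" and inv: "\<And>x. x \<in> S \<Longrightarrow> g (f x) = x" and "convex S"
    for f :: "'c::real_vector \<Rightarrow> 'd::real_vector" and g :: "'d \<Rightarrow> 'c" and S
  proof (rule image_subsetI)
    fix F assume F: "F \<in> facets S"
    then have fF: "F face_of S" "F \<noteq> {}" "affine_dim F = affine_dim S - 1"
      unfolding facets_def by auto
    have "affine_dim (f ` F) = affine_dim F"
      using inv face_of_imp_subset[OF fF(1)] by (intro affine_dim_linear_image[OF that(1,2)]) auto
    then show "f ` F \<in> facets (f ` S)"
      using face_of_linear_image_on[OF that(1-3) fF(1) that(4)] fF
        affine_dim_linear_image[OF that(1-3)] unfolding facets_def by simp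
  qed
  have gf: "g ` f ` S = S" using inv by force
  have inv': "\<And>y. y \<in> f ` S \<Longrightarrow> f (g y) = y" using inv by auto
  have "facets (f ` S) \<subseteq> (`) f ` facets S"
  proof
    fix H assume H: "H \<in> facets (f ` S)"
    then have "H \<subseteq> f ` S" unfolding facets_def using face_of_imp_subset by blast
    then have "f ` g ` H = H" using inv' by force
    moreover have "g ` H \<in> facets S"
      using sub[OF assms(2,1) inv' convex_linear_image[OF assms(1,4)]] H unfolding gf by blast
    ultimately show "H \<in> (`) f ` facets S" by (metis imageI)
  qed
  then show ?thesis using sub[OF assms] by blast
qed

lemma inj_on_image_facets:
  assumes "inj_on f S"
  shows "inj_on ((`) f) (facets S)"
proof (rule inj_onI)
  fix F G assume "F \<in> facets S" "G \<in> facets S" "f ` F = f ` G"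
  moreover from this have "F \<subseteq> S" "G \<subseteq> S"
    unfolding facets_def by (auto dest: face_of_imp_subset)
  ultimately show "F = G" using assms inj_on_image_eq_iff by metis
qed

text \<open>
  What makes it possible to move a simple polytope between a Euclidean space and a space of sequences.
\<close>
lemma simple_polytope_linear_image:
  assumes "linear f" "linear g" and inv: "\<And>x. x \<in> S \<Longrightarrow> g (f x) = x" and S: "simple_polytope S"
  shows "simple_polytope (f ` S)" and "card (facets (f ` S)) = card (facets S)"
proof -
  have "polytope S" using S unfolding simple_polytope_def by blast
  then have conv: "convex S" and poly: "polytope (f ` S)"
    by (auto simp: polytope_imp_convex polytope_linear_image assms(1))
  have inj: "inj_on f S" using inv by (metis inj_onI)
  note fac = facets_linear_image[OF assms(1-3) conv] and injF = inj_on_image_facets[OF inj]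
  have gf: "g ` f ` S = S" using inv by force
  have inv': "\<And>y. y \<in> f ` S \<Longrightarrow> f (g y) = y" using inv by auto
  show "card (facets (f ` S)) = card (facets S)"
    using fac card_image[OF injF] by simp
  have "int (card {F \<in> facets (f ` S). v \<in> F}) = affine_dim (f ` S)"
    if v: "v extreme_point_of f ` S" for v
  proof -
    have vS: "v \<in> f ` S" using v unfolding extreme_point_of_def by blast
    have "{v} face_of f ` S" using v by (simp add: face_of_singleton)
    from face_of_linear_image_on[OF assms(2,1) inv' this convex_linear_image[OF assms(1) conv]]
    have "g ` {v} face_of g ` f ` S" .
    then have ext: "g v extreme_point_of S" using gf by (simp add: face_of_singleton)
    have mem: "v \<in> f ` F \<longleftrightarrow> g v \<in> F" if "F \<in> facets S" for F
    proof
      have "F \<subseteq> S" using that unfolding facets_def by (auto dest: face_of_imp_subset)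
      then show "g v \<in> F" if "v \<in> f ` F" using that inv by auto
      show "v \<in> f ` F" if "g v \<in> F" using inv'[OF vS] that by (metis imageI)
    qed
    have "{F \<in> facets (f ` S). v \<in> F} = (`) f ` {F \<in> facets S. g v \<in> F}"
    proof (intro equalityI subsetI)
      fix H assume "H \<in> {F \<in> facets (f ` S). v \<in> F}"
      then obtain F where "F \<in> facets S" "H = f ` F" "v \<in> f ` F" using fac by blast
      then show "H \<in> (`) f ` {F \<in> facets S. g v \<in> F}" using mem by simp
    next
      fix H assume "H \<in> (`) f ` {F \<in> facets S. g v \<in> F}"
      then obtain F where "F \<in> facets S" "H = f ` F" "g v \<in> F" by blast
      then show "H \<in> {F \<in> facets (f ` S). v \<in> F}" using mem fac by simp
    qed
    then have "card {F \<in> facets (f ` S). v \<in> F} = card {F \<in> facets S. g v \<in> F}"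
      using card_image[of "(`) f" "{F \<in> facets S. g v \<in> F}"] inj_on_subset[OF injF] by auto
    then show ?thesis
      using S ext affine_dim_linear_image[OF assms(1-3)] unfolding simple_polytope_def by simp
  qed
  then show "simple_polytope (f ` S)" using poly unfolding simple_polytope_def by blast
qed

text \<open>
  An injection of \<open>C\<close> into \<open>C'\<close> and its inverse on the image both extend linearly.
\<close>
lemma linear_embedding_of_span:
  fixes C :: "'a::real_vector set" and C' :: "'b::real_vector set"
  assumes "independent C" "finite C" "independent C'" "finite C'" "card C \<le> card C'"
  obtains f :: "'a \<Rightarrow> 'b" and g :: "'b \<Rightarrow> 'a"
  where "linear f" "linear g" "\<And>x. x \<in> span C \<Longrightarrow> g (f x) = x" "f ` span C \<subseteq> span C'"
proof -
  obtain h where h: "h ` C \<subseteq> C'" "inj_on h C"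
    using card_le_inj assms by blast
  obtain f where f: "linear f" "\<And>x. x \<in> C \<Longrightarrow> f x = h x"
    using linear_independent_extend[OF assms(1), of h] by blast
  have "independent (h ` C)" using independent_mono assms(3) h(1) by blast
  then obtain g where g: "linear g" "\<And>y. y \<in> h ` C \<Longrightarrow> g y = inv_into C h y"
    using linear_independent_extend[of "h ` C" "inv_into C h"] by blast
  have "g (f x) = x" if "x \<in> C" for x
    using that f(2) g(2) h(2) by simp
  then have "\<And>x. x \<in> span C \<Longrightarrow> g (f x) = x"
    using linear_inverse_on_span[OF f(1) g(1)] by blast
  moreover have "f ` span C \<subseteq> span C'"
  proof -
    have "f ` C = h ` C" using f(2) by simp
    then have "f ` span C = span (h ` C)" using linear_span_image[OF f(1), of C] by simp
    then show ?thesis using span_mono[OF h(1)] by simp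
  qed
  ultimately show thesis using that f(1) g(1) by blast
qed

text \<open>
  An affine basis of \<open>Q\<close> has \<open>dim Q + 1\<close> points, and they span a space containing \<open>Q\<close>.
\<close>
lemma polytope_subset_span:
  fixes Q :: "'a::real_vector set"
  assumes "polytope Q" "Q \<noteq> {}"
  obtains C where "independent C" "finite C" "Q \<subseteq> span C" "int (card C) \<le> affine_dim Q + 1"
proof -
  let ?p = "\<lambda>d::int. \<exists>B. affine hull B = affine hull Q \<and> \<not> affine_dependent B \<and> of_nat (card B) = d + 1"
  obtain B0 where "affine hull B0 = affine hull Q" "\<not> affine_dependent B0"
    using affine_basis_exists[of Q] by metis
  then have "?p (int (card B0) - 1)" by (intro exI[of _ B0]) simp
  \<comment> \<open>Taking a basis for the dimension that was chosen avoids comparing the cardinalities of two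
     affine bases. As an infinite set has cardinality \<open>0\<close>, its finiteness is shown
     separately, from the finite set that generates \<open>Q\<close>.\<close>
  then have "?p (affine_dim Q)" unfolding affine_dim_def by (rule someI)
  then obtain B where B: "affine hull B = affine hull Q" "\<not> affine_dependent B"
    "int (card B) = affine_dim Q + 1" by blast
  obtain S where S: "finite S" "Q = convex hull S"
    using assms(1) unfolding polytope_def by blast
  have QB: "Q \<subseteq> span B"
    using B(1) affine_hull_subset_span[of B] hull_subset[of Q affine] by blast
  have "B \<noteq> {}" using B(1) assms(2) by (metis affine_hull_eq_empty)
  then obtain b where b: "b \<in> B" by blast
  have "affine hull Q = affine hull S" using S(2) by simp
  then have BS: "B \<subseteq> span S"
    using B(1) hull_subset[of B affine] affine_hull_subset_span[of S] by blast
  have "independent ((\<lambda>x. - b + x) ` (B - {b}))"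
    using B(2) affine_dependent_iff_dependent2[OF b] by blast
  moreover have "(\<lambda>x. - b + x) ` (B - {b}) \<subseteq> span S"
    using BS b by (intro image_subsetI span_add span_neg) auto
  ultimately have "finite ((\<lambda>x. - b + x) ` (B - {b}))"
    using independent_span_bound[OF S(1)] by blast
  then have "finite (B - {b})" by (rule finite_imageD) (simp add: inj_on_def)
  then have finB: "finite B" by simp
  obtain C where C: "C \<subseteq> B" "independent C" "B \<subseteq> span C"
    using maximal_independent_subset by blast
  have "Q \<subseteq> span C" using QB span_mono[OF C(3)] by (simp add: span_span)
  moreover have "finite C" "card C \<le> card B"
    using C(1) finB by (auto intro: finite_subset card_mono)
  ultimately show thesis using that C(2) B(3) by (metis of_nat_mono)
qed

text \<open>
  Any single vertex already lies in \<open>dim Q\<close> facets.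
\<close>
lemma simple_polytope_affine_dim_le:
  fixes Q :: "'a::real_vector set"
  assumes "simple_polytope Q" "Q \<noteq> {}"
  shows "affine_dim Q \<le> int (card (facets Q))"
proof -
  have Q: "polytope Q" using assms(1) unfolding simple_polytope_def by blast
  obtain v where "v extreme_point_of Q"
    using polytope_extreme_point_exists[OF Q assms(2)] by blast
  then have "affine_dim Q = int (card {F \<in> facets Q. v \<in> F})"
    using assms(1) unfolding simple_polytope_def by simp
  also have "\<dots> \<le> int (card (facets Q))"
    using card_mono[OF finite_facets[OF Q], of "{F \<in> facets Q. v \<in> F}"] by auto
  finally show ?thesis .
qed

section \<open>Vertices of simple polytopes\<close>

text \<open>
  In an irredundant description of \<open>S\<close> by half-spaces, each half-space \<open>h\<close> defines a facet. Two half-spaces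
  \<open>h, h'\<close> cannot define the same facet, so the description may be indexed by facets. Indeed, leaving out
  \<open>h'\<close> admits a point \<open>z\<close> of the affine hull that violates \<open>h'\<close> alone. Going from a point \<open>q\<close> of \<open>S\<close> off the
  facet towards \<open>z\<close>, one meets the hyperplane of \<open>h'\<close> in a point of \<open>S\<close> at which the inequality of \<open>h\<close> is
  still strict.
\<close>
lemma polyhedron_facet_inequalities:
  fixes S :: "'a::euclidean_space set"
  assumes "polyhedron S"
  obtains a :: "'a set \<Rightarrow> 'a" and b :: "'a set \<Rightarrow> real"
  where "\<And>F. F facet_of S \<Longrightarrow> F = S \<inter> {x. a F \<bullet> x = b F}"
    and "\<And>x. x \<in> S \<longleftrightarrow> x \<in> affine hull S \<and> (\<forall>F. F facet_of S \<longrightarrow> a F \<bullet> x \<le> b F)"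
proof -
  obtain H where H: "finite H" and seq: "S = affine hull S \<inter> \<Inter>H"
    and faces: "\<And>h. h \<in> H \<Longrightarrow> \<exists>a b. a \<noteq> 0 \<and> h = {x. a \<bullet> x \<le> b}"
    and min: "\<And>H'. H' \<subset> H \<Longrightarrow> S \<subset> affine hull S \<inter> \<Inter>H'"
    using assms by (simp add: polyhedron_Int_affine_minimal) meson
  then obtain a b where ab: "\<And>h. h \<in> H \<Longrightarrow> a h \<noteq> 0 \<and> h = {x. a h \<bullet> x \<le> b h}"
    by metis
  let ?F = "\<lambda>h. S \<inter> {x. a h \<bullet> x = b h}"
  have fac: "C facet_of S \<longleftrightarrow> (\<exists>h. h \<in> H \<and> C = ?F h)" for C
    by (rule facet_of_polyhedron_explicit[OF H seq ab min])
  have inj: "inj_on ?F H"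
  proof (rule inj_onI, rule ccontr)
    fix h h' assume h: "h \<in> H" and h': "h' \<in> H" and eq: "?F h = ?F h'" and ne: "h \<noteq> h'"
    obtain z where z: "z \<in> affine hull S" "\<And>g. g \<in> H \<Longrightarrow> g \<noteq> h' \<Longrightarrow> z \<in> g" "z \<notin> S"
      using min[of "H - {h'}"] h' by blast
    have zh': "a h' \<bullet> z > b h'" 
      using z seq ab[OF h'] h' by (metis IntI InterI mem_Collect_eq not_le_imp_less)
    have "?F h facet_of S" using fac h by blast
    then have "?F h face_of S" "?F h \<noteq> S" 
      by (auto simp: facet_of_imp_face_of facet_of_def)
    then obtain q where q: "q \<in> S" "q \<notin> ?F h" by blast
    have inS: "a g \<bullet> y \<le> b g" if "g \<in> H" "y \<in> S" for g y
      using that seq ab by blast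
    have qs: "a h \<bullet> q < b h" "a h' \<bullet> q < b h'"
      using q inS[OF h q(1)] inS[OF h' q(1)] eq by force+
    \<comment> \<open>the parameter at which the segment from \<open>q\<close> to \<open>z\<close> crosses the hyperplane of \<open>h'\<close>\<close>
    define t where "t = (b h' - a h' \<bullet> q) / (a h' \<bullet> z - a h' \<bullet> q)"
    have t: "0 < t" "t < 1" using qs zh' by (auto simp: t_def field_simps)
    define p where "p = (1 - t) *\<^sub>R q + t *\<^sub>R z"
    have ap: "a g \<bullet> p = (1 - t) * (a g \<bullet> q) + t * (a g \<bullet> z)" for g
      by (simp add: p_def inner_add_right)
    have aph': "a h' \<bullet> p = b h'"
    proof -
      have "t * (a h' \<bullet> z - a h' \<bullet> q) = b h' - a h' \<bullet> q"
        using qs zh' by (simp add: t_def)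
      then show ?thesis by (simp add: ap algebra_simps)
    qed
    have "p \<in> affine hull S"
      unfolding p_def using z(1) q(1) by (intro mem_affine) (auto simp: hull_inc)
    moreover have pg: "a g \<bullet> p \<le> b g" if "g \<in> H" for g
    proof (cases "g = h'")
      case False
      then have "a g \<bullet> z \<le> b g" using z(2) ab that by blast
      then show ?thesis using inS[OF that q(1)] t unfolding ap
        by (intro convex_bound_le) auto
    qed (simp add: aph')
    ultimately have "p \<in> S" using seq ab by blast
    then have "p \<in> ?F h" using aph' eq by blast
    moreover have "a h \<bullet> p < b h"
    proof -
      have "a h \<bullet> z \<le> b h" using z(2)[OF h ne] ab[OF h] by blast
      then have "t * (a h \<bullet> z) \<le> t * b h" "(1 - t) * (a h \<bullet> q) < (1 - t) * b h"
        using t qs by auto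
      then show ?thesis unfolding ap by (simp add: algebra_simps)
    qed
    ultimately show False by simp
  qed
  define hp where "hp = inv_into H ?F"
  have inv: "hp (?F h) = h" if "h \<in> H" for h
    unfolding hp_def using inj that by (rule inv_into_f_f)
  show thesis
  proof (rule that[of "\<lambda>F. a (hp F)" "\<lambda>F. b (hp F)"])
    fix F assume "F facet_of S"
    then obtain h where "h \<in> H" "F = ?F h" using fac by blast
    then show "F = S \<inter> {x. a (hp F) \<bullet> x = b (hp F)}" using inv by simp
  next
    fix x
    have "x \<in> S \<longleftrightarrow> x \<in> affine hull S \<and> (\<forall>h\<in>H. a h \<bullet> x \<le> b h)"
      using seq ab by blast
    moreover have "(\<forall>h\<in>H. a h \<bullet> x \<le> b h) \<longleftrightarrow> (\<forall>F. F facet_of S \<longrightarrow> a (hp F) \<bullet> x \<le> b (hp F))"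
    proof (intro iffI allI impI ballI)
      fix F assume *: "\<forall>h\<in>H. a h \<bullet> x \<le> b h" and "F facet_of S"
      then obtain h where "h \<in> H" "F = ?F h" using fac by blast
      then show "a (hp F) \<bullet> x \<le> b (hp F)" using * inv by simp
    next
      fix h assume *: "\<forall>F. F facet_of S \<longrightarrow> a (hp F) \<bullet> x \<le> b (hp F)" and h: "h \<in> H"
      then have "?F h facet_of S" using fac by blast
      then have "a (hp (?F h)) \<bullet> x \<le> b (hp (?F h))" by (rule *[rule_format])
      then show "a h \<bullet> x \<le> b h" unfolding inv[OF h] .
    qed
    ultimately show "x \<in> S \<longleftrightarrow> x \<in> affine hull S \<and> (\<forall>F. F facet_of S \<longrightarrow> a (hp F) \<bullet> x \<le> b (hp F))"
      by simp
  qed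
qed

lemma aff_dim_Int_hyperplanes_ge:
  fixes S :: "'a::euclidean_space set"
  assumes "finite A" "affine S" "x \<in> S" "\<And>F. F \<in> A \<Longrightarrow> a F \<bullet> x = b F"
  shows "aff_dim (S \<inter> {y. \<forall>F\<in>A. a F \<bullet> y = b F}) \<ge> aff_dim S - int (card A)"
    and "affine (S \<inter> {y. \<forall>F\<in>A. a F \<bullet> y = b F})"
proof -
  have "aff_dim (S \<inter> {y. \<forall>F\<in>A. a F \<bullet> y = b F}) \<ge> aff_dim S - int (card A)
    \<and> affine (S \<inter> {y. \<forall>F\<in>A. a F \<bullet> y = b F})"
    using assms(1,4)
  proof (induction A)
    case (insert F A)
    let ?L = "S \<inter> {y. \<forall>F\<in>A. a F \<bullet> y = b F}"
    have IH: "aff_dim ?L \<ge> aff_dim S - int (card A)" "affine ?L" using insert by auto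
    have eq: "S \<inter> {y. \<forall>F\<in>insert F A. a F \<bullet> y = b F} = ?L \<inter> {y. a F \<bullet> y = b F}" by auto
    have "x \<in> ?L \<inter> {y. a F \<bullet> y = b F}" using insert.prems assms(3) by auto
    then have "aff_dim (?L \<inter> {y. a F \<bullet> y = b F}) \<ge> aff_dim ?L - 1"
      using aff_dim_affine_Int_hyperplane[OF IH(2), of "a F" "b F"] by auto
    then show ?case unfolding eq using IH insert.hyps
      by (auto intro: affine_Int affine_hyperplane)
  qed (use assms(2) in auto)
  then show "aff_dim (S \<inter> {y. \<forall>F\<in>A. a F \<bullet> y = b F}) \<ge> aff_dim S - int (card A)"
    and "affine (S \<inter> {y. \<forall>F\<in>A. a F \<bullet> y = b F})" by auto
qed

text \<open>
  At a vertex \<open>v\<close> of a simple polytope, the facets through \<open>v\<close> other than \<open>f\<close> meet in an edge that leaves \<open>f\<close>,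
  and \<open>z\<close> is a point on this edge. The \<open>dim Q - 1\<close> hyperplanes of the other facets through \<open>v\<close> have a line in common; a short piece of that line
  satisfies the inequalities of the facets that avoid \<open>v\<close>. If the line were parallel to \<open>f\<close>, then \<open>v\<close> would be
  inside a segment of \<open>Q\<close>; otherwise one of its two directions points into \<open>Q\<close>.
\<close>
lemma edge_leaving_facet:
  fixes Q :: "'a::euclidean_space set"
  assumes Q: "polytope Q" and v: "v extreme_point_of Q"
    and card: "int (card {F. F facet_of Q \<and> v \<in> F}) = aff_dim Q"
    and f: "f facet_of Q" "v \<in> f"
  obtains z where "z \<in> Q" "z \<notin> f" "\<And>F. F facet_of Q \<Longrightarrow> v \<in> F \<Longrightarrow> F \<noteq> f \<Longrightarrow> z \<in> F"
proof -
  obtain a b where Feq: "\<And>F. F facet_of Q \<Longrightarrow> F = Q \<inter> {x. a F \<bullet> x = b F}"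
    and Qeq: "\<And>x. x \<in> Q \<longleftrightarrow> x \<in> affine hull Q \<and> (\<forall>F. F facet_of Q \<longrightarrow> a F \<bullet> x \<le> b F)"
    by (rule polyhedron_facet_inequalities[OF polytope_imp_polyhedron[OF Q]]) blast
  have vQ: "v \<in> Q" using v unfolding extreme_point_of_def by blast
  have fin: "finite {F. F facet_of Q}" using finite_polytope_facets[OF Q] .
  define A where "A = {F. F facet_of Q \<and> v \<in> F} - {f}"
  have "finite {F. F facet_of Q \<and> v \<in> F}" using fin by (rule rev_finite_subset) auto
  then have finA: "finite A" and cardA: "int (card A) = aff_dim Q - 1"
    using card f card_Suc_Diff1[of "{F. F facet_of Q \<and> v \<in> F}" f] by (auto simp: A_def)
  let ?L = "affine hull Q \<inter> {y. \<forall>F\<in>A. a F \<bullet> y = b F}"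
  have vA: "a F \<bullet> v = b F" if "F \<in> A" for F using that Feq unfolding A_def by blast
  have vL: "v \<in> ?L" using vQ vA by (auto simp: hull_inc)
  have "aff_dim ?L \<ge> 1"
    using aff_dim_Int_hyperplanes_ge(1)[OF finA affine_affine_hull _ vA, of Q] vQ cardA
    by (auto simp: hull_inc)
  moreover have "affine ?L"
    using aff_dim_Int_hyperplanes_ge(2)[OF finA affine_affine_hull _ vA, of Q] vQ
    by (auto simp: hull_inc)
  ultimately have "?L \<noteq> {v}" by auto
  then obtain y where y: "y \<in> ?L" "y \<noteq> v" using vL by blast
  define r where "r = y - v"
  have r0: "r \<noteq> 0" using y by (simp add: r_def)
  have rA: "a F \<bullet> r = 0" if "F \<in> A" for F using y(1) vA that by (simp add: r_def inner_diff_right)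
  have line_aff: "v + c *\<^sub>R r \<in> affine hull Q" for c
  proof -
    have "v + c *\<^sub>R r = (1 - c) *\<^sub>R v + c *\<^sub>R y" by (simp add: r_def algebra_simps)
    then show ?thesis using y(1) vL by (auto intro!: mem_affine)
  qed
  \<comment> \<open>the parameters for which the facets that avoid \<open>v\<close> impose no restriction\<close>
  define U where "U = (\<Inter>F\<in>{F. F facet_of Q \<and> v \<notin> F}. {c. a F \<bullet> v + c * (a F \<bullet> r) < b F})"
  have "finite {F. F facet_of Q \<and> v \<notin> F}" using fin by (rule rev_finite_subset) auto
  then have "open U" unfolding U_def
    by (intro open_INT ballI open_Collect_less continuous_intros)
  moreover have "0 \<in> U"
  proof -
    have "a F \<bullet> v < b F" if "F facet_of Q" "v \<notin> F" for F
    proof -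
      have "a F \<bullet> v \<le> b F" using Qeq vQ that(1) by blast
      moreover have "a F \<bullet> v \<noteq> b F" using Feq[OF that(1)] that(2) vQ by blast
      ultimately show ?thesis by simp
    qed
    then show ?thesis unfolding U_def by auto
  qed
  ultimately obtain e where e: "e > 0" "ball 0 e \<subseteq> U" by (meson open_contains_ball)
  have inQ: "v + c *\<^sub>R r \<in> Q" if c: "\<bar>c\<bar> < e" "c * (a f \<bullet> r) \<le> 0" for c
  proof -
    have "c \<in> U" using e c(1) by auto
    have "a F \<bullet> (v + c *\<^sub>R r) \<le> b F" if F: "F facet_of Q" for F
    proof (cases "v \<in> F")
      case False
      then show ?thesis using \<open>c \<in> U\<close> F unfolding U_def by (auto simp: inner_add_right)
    next
      case True
      then have "a F \<bullet> v = b F" using Feq F by blast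
      then show ?thesis using True F rA[of F] c(2)
        by (cases "F = f") (auto simp: A_def inner_add_right)
    qed
    then show ?thesis using Qeq line_aff by blast
  qed
  have afr: "a f \<bullet> r \<noteq> 0"
  proof
    assume 0: "a f \<bullet> r = 0"
    have "v + (e/2) *\<^sub>R r \<in> Q" "v - (e/2) *\<^sub>R r \<in> Q"
      using inQ[of "e/2"] inQ[of "- e/2"] 0 e(1) by simp_all
    then have "(e/2) *\<^sub>R r = 0" by (rule extreme_point_no_symmetric_translate[OF v])
    then show False using r0 e(1) by simp
  qed
  define c where "c = (if a f \<bullet> r < 0 then e/2 else - e/2)"
  have c: "\<bar>c\<bar> < e" "c * (a f \<bullet> r) < 0"
    using afr e(1) by (auto simp: c_def mult_less_0_iff)
  show thesis
  proof (rule that)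
    show zQ: "v + c *\<^sub>R r \<in> Q" using inQ c by auto
    have "a f \<bullet> v = b f" using Feq f by blast
    then have "a f \<bullet> (v + c *\<^sub>R r) \<noteq> b f" using c(2) by (auto simp: inner_add_right)
    then show "v + c *\<^sub>R r \<notin> f" using Feq[OF f(1)] by blast
    fix F assume F: "F facet_of Q" "v \<in> F" "F \<noteq> f"
    then have "F \<in> A" unfolding A_def by simp
    then have "a F \<bullet> (v + c *\<^sub>R r) = b F" using vA rA by (simp add: inner_add_right)
    then show "v + c *\<^sub>R r \<in> F" using zQ Feq[OF F(1)] by blast
  qed
qed

text \<open>
  Choose a vertex \<open>v\<close> in \<open>G1 \<inter> G2\<close>. A face through \<open>v\<close> that is not inside \<open>f\<close> is an intersection of facets
  through \<open>v\<close> other than \<open>f\<close> (or all of \<open>Q\<close>), so it contains the edge at \<open>v\<close> that leaves \<open>f\<close>. If this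
  held for both \<open>G1\<close> and \<open>G2\<close>, the edge would be in \<open>G1 \<inter> G2 \<subseteq> f\<close>.
\<close>
lemma simple_polytope_facet_contains_one_face:
  fixes Q :: "'a::euclidean_space set"
  assumes Q: "simple_polytope Q" and G: "G1 face_of Q" "G2 face_of Q"
    and ne: "G1 \<inter> G2 \<noteq> {}" and f: "f facet_of Q" "G1 \<inter> G2 \<subseteq> f"
  shows "G1 \<subseteq> f \<or> G2 \<subseteq> f"
proof (rule ccontr)
  assume neg: "\<not> (G1 \<subseteq> f \<or> G2 \<subseteq> f)"
  have poly: "polytope Q" using Q unfolding simple_polytope_def by blast
  have face: "G1 \<inter> G2 face_of Q" using G by (rule face_of_Int)
  have "compact (G1 \<inter> G2)" "convex (G1 \<inter> G2)"
    using face face_of_imp_compact face_of_imp_convex poly polytope_imp_compact polytope_imp_convex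
    by blast+
  then obtain v where "v extreme_point_of (G1 \<inter> G2)"
    using extreme_point_exists_convex ne by blast
  then have v: "v extreme_point_of Q" "v \<in> G1" "v \<in> G2"
    using extreme_point_of_face[OF face] by auto
  have "int (card {F. F facet_of Q \<and> v \<in> F}) = aff_dim Q"
    using Q v(1) unfolding simple_polytope_def by (simp add: facets_eq affine_dim_eq_aff_dim)
  then obtain z where z: "z \<in> Q" "z \<notin> f"
    and zF: "\<And>F. F facet_of Q \<Longrightarrow> v \<in> F \<Longrightarrow> F \<noteq> f \<Longrightarrow> z \<in> F"
    using edge_leaving_facet[OF poly v(1) _ f(1)] f(2) v by blast
  have "z \<in> G" if "G face_of Q" "v \<in> G" "\<not> G \<subseteq> f" for G
  proof (cases "G = Q")
    case False
    then have "G = \<Inter>{F. F facet_of Q \<and> G \<subseteq> F}"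
      using face_of_polyhedron[OF polytope_imp_polyhedron[OF poly] that(1)] that(2) by blast
    moreover have "z \<in> F" if "F facet_of Q" "G \<subseteq> F" for F
      using zF that \<open>v \<in> G\<close> \<open>\<not> G \<subseteq> f\<close> by blast
    ultimately show ?thesis by blast
  qed (use z in simp)
  then show False using G v neg z(2) f(2) by blast
qed

section \<open>Vertices and faces of hypersimplices\<close>

definition incidence_vector :: "'n::finite set \<Rightarrow> real ^ 'n" where
  "incidence_vector A = (\<chi> i. if i \<in> A then 1 else 0)"

lemma incidence_vector_nth [simp]: "incidence_vector A $ i = (if i \<in> A then 1 else 0)"
  by (simp add: incidence_vector_def)

lemma inj_incidence_vector: "inj incidence_vector"
proof (rule injI)
  fix A B :: "'a set" assume eq: "incidence_vector A = incidence_vector B"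
  have "i \<in> A \<longleftrightarrow> i \<in> B" for i
    using arg_cong[OF eq, of "\<lambda>x. x $ i"] by (simp split: if_splits)
  then show "A = B" by blast
qed

lemma sum_incidence_vector: "(\<Sum>i\<in>UNIV. incidence_vector A $ i) = real (card A)"
  by (simp add: sum.If_cases)

lemma incidence_vector_in_hypersimplex:
  "incidence_vector A \<in> hypersimplex k \<longleftrightarrow> card A = k"
  unfolding hypersimplex_def using sum_incidence_vector[of A] by auto

lemma convex_hypersimplex: "convex (hypersimplex k)"
proof (rule convexI)
  fix x y :: "real ^ 'n" and u v :: real
  assume x: "x \<in> hypersimplex k" and y: "y \<in> hypersimplex k" and uv: "0 \<le> u" "0 \<le> v" "u + v = 1"
  have "u * x $ i + v * y $ i \<le> 1" "0 \<le> u * x $ i + v * y $ i" for i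
    using x y uv by (auto simp: hypersimplex_def intro: convex_bound_le)
  moreover have "(\<Sum>i\<in>UNIV. u * x $ i + v * y $ i) = u * real k + v * real k"
    using x y by (simp add: hypersimplex_def sum.distrib flip: sum_distrib_left)
  then have "(\<Sum>i\<in>UNIV. u * x $ i + v * y $ i) = real k"
    using uv(3) by (simp flip: distrib_right)
  ultimately show "u *\<^sub>R x + v *\<^sub>R y \<in> hypersimplex k"
    by (simp add: hypersimplex_def)
qed

lemma compact_hypersimplex: "compact (hypersimplex k :: (real ^ 'n::finite) set)"
proof -
  have eq: "hypersimplex k = (\<Inter>i. {x::real^'n. 0 \<le> x $ i} \<inter> {x. x $ i \<le> 1})
      \<inter> {x. (\<Sum>i\<in>UNIV. x $ i) = real k}"
    by (auto simp: hypersimplex_def)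
  have "closed (hypersimplex k :: (real ^ 'n) set)"
    unfolding eq by (intro closed_Int closed_INT ballI closed_Collect_le closed_Collect_eq continuous_intros)
  moreover have "hypersimplex k \<subseteq> cbox (0 :: real ^ 'n) 1"
    by (auto simp: hypersimplex_def mem_box_cart)
  ultimately show ?thesis
    using bounded_cbox bounded_subset compact_eq_bounded_closed by blast
qed

lemma face_of_hypersimplex:
  "{x \<in> hypersimplex k. (\<forall>i\<in>I. x $ i = 1) \<and> (\<forall>i\<in>J. x $ i = 0)} face_of hypersimplex k"
  (is "?T face_of ?P")
proof -
  have "?T \<subseteq> ?P" by auto
  moreover have "convex ?T"
  proof (rule convexI)
    fix x y :: "real ^ 'a" and u v :: real
    assume x: "x \<in> ?T" and y: "y \<in> ?T" and uv: "0 \<le> u" "0 \<le> v" "u + v = 1"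
    then show "u *\<^sub>R x + v *\<^sub>R y \<in> ?T"
      using convexD[OF convex_hypersimplex, of x k y u v] by auto
  qed
  moreover have "a \<in> ?T \<and> b \<in> ?T"
    if ab: "a \<in> ?P" "b \<in> ?P" and x: "x \<in> ?T" "x \<in> open_segment a b" for a b x
  proof -
    obtain u where u: "0 < u" "u < 1" "x = (1 - u) *\<^sub>R a + u *\<^sub>R b"
      using x(2) by (auto simp: in_segment)
    have xi: "x $ i = (1 - u) * a $ i + u * b $ i" for i using u(3) by simp
    have bnd: "0 \<le> a $ i" "a $ i \<le> 1" "0 \<le> b $ i" "b $ i \<le> 1" for i
      using ab by (auto simp: hypersimplex_def)
    have "a $ i = 1 \<and> b $ i = 1" if "i \<in> I" for i
    proof -
      have "(1 - u) * (1 - a $ i) + u * (1 - b $ i) = 0"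
        using xi[of i] x(1) that by (simp add: algebra_simps)
      moreover have "0 \<le> (1 - u) * (1 - a $ i)" "0 \<le> u * (1 - b $ i)" using u bnd by auto
      ultimately have "(1 - u) * (1 - a $ i) = 0" "u * (1 - b $ i) = 0" by linarith+
      then show ?thesis using u by simp
    qed
    moreover have "a $ i = 0 \<and> b $ i = 0" if "i \<in> J" for i
    proof -
      have "(1 - u) * a $ i + u * b $ i = 0" using xi[of i] x(1) that by simp
      moreover have "0 \<le> (1 - u) * a $ i" "0 \<le> u * b $ i" using u bnd by auto
      ultimately have "(1 - u) * a $ i = 0" "u * b $ i = 0" by linarith+
      then show ?thesis using u by simp
    qed
    ultimately show ?thesis using ab by simp
  qed
  ultimately show ?thesis unfolding face_of_def by blast
qed

lemma hypersimplex_eq_incidence_vector_if_ones: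
  assumes "x \<in> hypersimplex k" "card A = k" "\<And>i. i \<in> A \<Longrightarrow> x $ i = 1"
  shows "x = incidence_vector A"
proof -
  have s: "(\<Sum>i\<in>UNIV. x $ i) = real k" and nn: "\<And>i. 0 \<le> x $ i"
    using assms(1) by (auto simp: hypersimplex_def)
  have "(\<Sum>i\<in>UNIV. x $ i) = (\<Sum>i\<in>A. x $ i) + (\<Sum>i\<in>-A. x $ i)"
    using sum.subset_diff[of A UNIV "\<lambda>i. x $ i"] by (simp add: Compl_eq_Diff_UNIV)
  then have "(\<Sum>i\<in>-A. x $ i) = 0" using s assms(2,3) by simp
  then have "x $ i = 0" if "i \<notin> A" for i
    using that nn by (simp add: sum_nonneg_eq_0_iff)
  then show ?thesis using assms(3) by (simp add: vec_eq_iff)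
qed

lemma hypersimplex_eq_incidence_vector_if_zeros:
  assumes "x \<in> hypersimplex k" "card A = k" "\<And>i. i \<notin> A \<Longrightarrow> x $ i = 0"
  shows "x = incidence_vector A"
proof -
  have s: "(\<Sum>i\<in>UNIV. x $ i) = real k" and le1: "\<And>i. x $ i \<le> 1"
    using assms(1) by (auto simp: hypersimplex_def)
  have "(\<Sum>i\<in>A. x $ i) = real k"
    using s sum.mono_neutral_left[of UNIV A "\<lambda>i. x $ i"] assms(3) by auto
  then have "(\<Sum>i\<in>A. 1 - x $ i) = 0" using assms(2) by (simp add: sum_subtractf)
  then have "x $ i = 1" if "i \<in> A" for i
    using that le1 by (simp add: sum_nonneg_eq_0_iff)
  then show ?thesis using assms(3) by (simp add: vec_eq_iff)
qed

text \<open>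
  A point with an entry strictly between \<open>0\<close> and \<open>1\<close> has a second such entry, because the entries add up to an
  integer. Raising one and lowering the other by the same small amount, in both directions,
  shows that the point is not extreme.
\<close>
lemma extreme_points_hypersimplex:
  "{x :: real ^ 'n::finite. x extreme_point_of hypersimplex k} = incidence_vector ` {A. card A = k}"
proof (intro equalityI subsetI)
  fix x :: "real ^ 'n" assume "x \<in> incidence_vector ` {A. card A = k}"
  then obtain A where A: "card A = k" "x = incidence_vector A" by blast
  have "{x \<in> hypersimplex k. (\<forall>i\<in>A. x $ i = 1) \<and> (\<forall>i\<in>{}. x $ i = 0)} = {incidence_vector A}"
    using hypersimplex_eq_incidence_vector_if_ones[OF _ A(1)] A(1)
    by (auto simp: incidence_vector_in_hypersimplex)
  then have "{x} face_of hypersimplex k" using face_of_hypersimplex[of k A "{}"] A(2) by metis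
  then show "x \<in> {x. x extreme_point_of hypersimplex k}" by (simp add: face_of_singleton)
next
  fix x :: "real ^ 'n" assume "x \<in> {x. x extreme_point_of hypersimplex k}"
  then have ext: "x extreme_point_of hypersimplex k" by simp
  then have x: "x \<in> hypersimplex k"
    unfolding extreme_point_of_def by auto
  have s: "(\<Sum>i\<in>UNIV. x $ i) = real k" and bnd: "\<And>i. 0 \<le> x $ i \<and> x $ i \<le> 1"
    using x by (auto simp: hypersimplex_def)
  have int: "x $ i = 0 \<or> x $ i = 1" for i
  proof (rule ccontr)
    assume "\<not> (x $ i = 0 \<or> x $ i = 1)"
    then have i: "0 < x $ i" "x $ i < 1" using bnd[of i] by auto
    obtain j where j: "j \<noteq> i" "0 < x $ j" "x $ j < 1"
    proof (rule ccontr)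
      assume "\<not> thesis"
      then have "x $ j = 0 \<or> x $ j = 1" if "j \<noteq> i" for j
        using that bnd[of j] \<open>\<And>j. _ \<Longrightarrow> _ \<Longrightarrow> _ \<Longrightarrow> thesis\<close> by force
      then have "x $ j \<in> \<int>" if "j \<noteq> i" for j using that by (metis Ints_0 Ints_1)
      then have "(\<Sum>j\<in>UNIV - {i}. x $ j) \<in> \<int>" by (intro Ints_sum) auto
      moreover have "x $ i = real k - (\<Sum>j\<in>UNIV - {i}. x $ j)"
        using s by (simp add: sum_diff1)
      ultimately have "x $ i \<in> \<int>" by simp
      then obtain m where "x $ i = of_int m" by (elim Ints_cases)
      then show False using i by simp
    qed
    \<comment> \<open>the largest shift that keeps both entries between \<open>0\<close> and \<open>1\<close>\<close>
    define e where "e = min (min (x $ i) (1 - x $ i)) (min (x $ j) (1 - x $ j))"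
    have e: "0 < e" "e \<le> x $ i" "e \<le> 1 - x $ i" "e \<le> x $ j" "e \<le> 1 - x $ j"
      using i j by (auto simp: e_def)
    define r :: "real ^ 'n" where "r = axis i 1 - axis j 1"
    have "(\<Sum>l\<in>UNIV. r $ l) = 0"
      by (simp add: r_def axis_def sum_subtractf sum.delta)
    moreover have "r $ l = (if l = i then 1 else if l = j then - 1 else 0)" for l
      using j(1) by (auto simp: r_def axis_def)
    ultimately have inP: "x + c *\<^sub>R r \<in> hypersimplex k" if "\<bar>c\<bar> \<le> e" for c
      using that s bnd e
      by (auto simp: hypersimplex_def sum.distrib simp flip: sum_distrib_left)
    have "x + e *\<^sub>R r \<in> hypersimplex k" "x - e *\<^sub>R r \<in> hypersimplex k"
      using inP[of e] inP[of "- e"] e(1) by simp_all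
    then have "e *\<^sub>R r = 0" by (rule extreme_point_no_symmetric_translate[OF ext])
    moreover have "r $ i = 1" using j(1) by (simp add: r_def axis_def)
    ultimately show False using e(1) by auto
  qed
  define A where "A = {i. x $ i = 1}"
  have xA: "x = incidence_vector A"
    using int by (auto simp: vec_eq_iff A_def)
  then have "card A = k" using x by (simp add: incidence_vector_in_hypersimplex)
  then show "x \<in> incidence_vector ` {A. card A = k}" using xA by blast
qed

lemma card_extreme_points_hypersimplex:
  "card {x :: real ^ 'n::finite. x extreme_point_of hypersimplex k} = CARD('n) choose k"
proof -
  have "card {x :: real ^ 'n. x extreme_point_of hypersimplex k} = card {A :: 'n set. card A = k}"
    unfolding extreme_points_hypersimplex
    by (rule card_image) (rule inj_on_subset[OF inj_incidence_vector], simp)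
  also have "\<dots> = CARD('n) choose k" using n_subsets[of "UNIV :: 'n set" k] by simp
  finally show ?thesis .
qed

text \<open>
  For \<open>k\<close>-sets \<open>A\<close> and \<open>B\<close> this is the smallest face that contains the vertices with supports \<open>A\<close> and \<open>B\<close>; its vertices are those whose supports
  lie between \<open>A \<inter> B\<close> and \<open>A \<union> B\<close>.
\<close>
definition interval_face :: "nat \<Rightarrow> 'n::finite set \<Rightarrow> 'n set \<Rightarrow> (real ^ 'n) set" where
  "interval_face k A B =
    {x \<in> hypersimplex k. (\<forall>i\<in>A \<inter> B. x $ i = 1) \<and> (\<forall>i\<in>- (A \<union> B). x $ i = 0)}"

lemma interval_face_face_of: "interval_face k A B face_of hypersimplex k"
  unfolding interval_face_def by (rule face_of_hypersimplex)

lemma endpoints_in_interval_face: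
  assumes "card A = k"
  shows "incidence_vector A \<in> interval_face k A B" "incidence_vector A \<in> interval_face k B A"
  using assms by (auto simp: interval_face_def incidence_vector_in_hypersimplex)

text \<open>
  A common point \<open>x\<close> has entry \<open>1\<close> on \<open>C \<inter> (A \<union> B)\<close> and entry \<open>0\<close> outside \<open>C \<union> (A \<inter> B)\<close>. Under the first
  alternative it is \<open>1\<close> on \<open>C\<close>, under the second it is \<open>0\<close> off \<open>C\<close>, and since the entries add up to \<open>k = card C\<close>
  either one determines \<open>x\<close>.
\<close>
lemma interval_faces_Int:
  assumes "card C = k" and C: "C \<subseteq> A \<union> B \<or> A \<inter> B \<subseteq> C"
  shows "interval_face k C A \<inter> interval_face k C B = {incidence_vector C}"
proof -
  have "x = incidence_vector C" if x: "x \<in> interval_face k C A" "x \<in> interval_face k C B" for x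
    using C
  proof
    assume "C \<subseteq> A \<union> B"
    then show ?thesis using x assms(1)
      by (intro hypersimplex_eq_incidence_vector_if_ones[of x k C]) (auto simp: interval_face_def)
  next
    assume "A \<inter> B \<subseteq> C"
    then show ?thesis using x assms(1)
      by (intro hypersimplex_eq_incidence_vector_if_zeros[of x k C]) (auto simp: interval_face_def)
  qed
  then show ?thesis using endpoints_in_interval_face[OF assms(1)] by blast
qed

section \<open>Families of sets closed under intervals\<close>

lemma exists_other_set_same_card:
  fixes A :: "'n::finite set"
  assumes "1 \<le> card A" "card A < CARD('n)"
  obtains C where "card C = card A" "C \<noteq> A"
proof -
  obtain a where a: "a \<in> A" using assms(1) by fastforce
  obtain b where b: "b \<notin> A" using assms(2) by (metis UNIV_eq_I nat_neq_iff)
  have "card (insert b (A - {a})) = card A"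
    using a b by (metis card_Suc_Diff1 card_insert_disjoint finite Diff_iff)
  moreover have "insert b (A - {a}) \<noteq> A" using b by blast
  ultimately show thesis by (rule that)
qed

text \<open>
  Start at \<open>A\<close> and exchange one element at a time until \<open>C\<close> is reached; the claim is that an exchange
  \<open>A - {a} \<union> {c}\<close> stays in \<open>Z\<close>. With \<open>b \<in> B - A\<close>, the set \<open>X = A - {a} \<union> {b}\<close> is contained in \<open>A \<union> B\<close>, so it is
  in \<open>Z\<close>. Now \<open>A \<inter> X = A - {a}\<close> is contained in \<open>A - {a} \<union> {c}\<close>, so the latter is in \<open>Z\<close> as well. The old
  set \<open>A\<close> serves as the second member of \<open>Z\<close> in the next exchange.
\<close>
lemma closed_family_is_everything:
  fixes Z :: "'n::finite set set"
  assumes cardZ: "\<And>A. A \<in> Z \<Longrightarrow> card A = k"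
    and closed: "\<And>A B C. A \<in> Z \<Longrightarrow> B \<in> Z \<Longrightarrow> card C = k \<Longrightarrow> C \<subseteq> A \<union> B \<or> A \<inter> B \<subseteq> C \<Longrightarrow> C \<in> Z"
    and "A \<in> Z" "B \<in> Z" "A \<noteq> B" "card C = k"
  shows "C \<in> Z"
  using assms(3-5)
proof (induction "card (C - A)" arbitrary: A B)
  case 0
  then have "C \<subseteq> A" by simp
  then have "C = A" using cardZ[OF 0(2)] assms(6) by (simp add: card_subset_eq)
  then show ?case using 0 by simp
next
  case (Suc m)
  have swap: "card (insert y (A - {x})) = k" if "x \<in> A" "y \<notin> A" for x y
    using that cardZ[OF Suc.prems(1)] by (metis card_Suc_Diff1 card_insert_disjoint finite Diff_iff)
  obtain c where c: "c \<in> C" "c \<notin> A" using Suc.hyps(2) by (metis Diff_eq_empty_iff card.empty nat.simps(3) subsetI)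
  have "\<not> A \<subseteq> C"
    using card_subset_eq[of C A] cardZ[OF Suc.prems(1)] assms(6) c by auto
  then obtain a where a: "a \<in> A" "a \<notin> C" by blast
  have "\<not> B \<subseteq> A"
    using card_subset_eq[of A B] cardZ[OF Suc.prems(1)] cardZ[OF Suc.prems(2)] Suc.prems(3) by auto
  then obtain b where b: "b \<in> B" "b \<notin> A" by blast
  let ?X = "insert b (A - {a})" and ?Y = "insert c (A - {a})"
  have "?X \<in> Z"
    using b by (intro closed[OF Suc.prems(1,2) swap[OF a(1) b(2)]]) auto
  then have Y: "?Y \<in> Z"
    using b by (intro closed[OF Suc.prems(1) _ swap[OF a(1) c(2)]]) auto
  have "C - ?Y = (C - A) - {c}" using a by auto
  then have "m = card (C - ?Y)" using Suc.hyps(2) c by simp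
  moreover have "?Y \<noteq> A" using c by blast
  ultimately show ?case using Suc.hyps(1) Y Suc.prems(1) by blast
qed

section \<open>The lower bound\<close>

text \<open>
  Any facet that contains the fibre over \<open>C\<close> but not the one over \<open>A\<close> has this property: the family of sets
  whose fibres it does not contain is closed and omits \<open>C\<close>, so it has no member besides \<open>A\<close>.
\<close>
lemma simple_extension_facet_missing_one_fibre:
  fixes Q :: "'e::euclidean_space set" and p :: "'e \<Rightarrow> real ^ 'n::finite"
  assumes Q: "simple_polytope Q" and p: "linear p" "p ` Q = hypersimplex k"
    and A: "card A = k" and C: "card C = k" "C \<noteq> A"
  obtains f where "f facet_of Q"
    "{B. card B = k \<and> \<not> Q \<inter> p -` {incidence_vector B} \<subseteq> f} = {A}"
proof -
  have poly: "polytope Q" using Q unfolding simple_polytope_def by blast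
  define G where "G B = Q \<inter> p -` {incidence_vector B}" for B
  have G_ne: "G B \<noteq> {}" if "card B = k" for B
  proof -
    have "incidence_vector B \<in> p ` Q"
      using that by (simp add: p(2) incidence_vector_in_hypersimplex)
    then show ?thesis unfolding G_def by auto
  qed
  have face: "Q \<inter> p -` T face_of Q" if "T face_of hypersimplex k" for T
    by (rule face_of_linear_preimage[OF p(1) _ polytope_imp_convex[OF poly] that]) (simp add: p(2))
  have "incidence_vector C extreme_point_of hypersimplex k"
    using extreme_points_hypersimplex[where 'n='n] C(1) by blast
  then have GC: "G C face_of Q"
    unfolding G_def by (intro face) (simp add: face_of_singleton)
  have disj: "G A \<inter> G C = {}"
    using C(2) inj_incidence_vector unfolding G_def by (auto dest: injD)
  have "G A \<subseteq> Q" unfolding G_def by blast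
  then have "G C \<noteq> Q" using G_ne[OF A] disj by blast
  then have GC_eq: "G C = \<Inter>{F. F facet_of Q \<and> G C \<subseteq> F}"
    by (rule face_of_polyhedron[OF polytope_imp_polyhedron[OF poly] GC G_ne[OF C(1)]])
  have "\<not> G A \<subseteq> \<Inter>{F. F facet_of Q \<and> G C \<subseteq> F}"
    unfolding GC_eq[symmetric] using disj G_ne[OF A] by blast
  then obtain f where f: "f facet_of Q" "G C \<subseteq> f" "\<not> G A \<subseteq> f" by blast
  define Z where "Z = {B. card B = k \<and> \<not> G B \<subseteq> f}"
  have closed: "E \<in> Z"
    if "B \<in> Z" "D \<in> Z" and E: "card E = k" "E \<subseteq> B \<union> D \<or> B \<inter> D \<subseteq> E" for B D E
  proof (rule ccontr)
    assume "E \<notin> Z"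
    then have "G E \<subseteq> f" using E(1) unfolding Z_def by blast
    let ?G1 = "Q \<inter> p -` interval_face k E B" and ?G2 = "Q \<inter> p -` interval_face k E D"
    have "?G1 \<inter> ?G2 = Q \<inter> p -` (interval_face k E B \<inter> interval_face k E D)" by blast
    then have Int: "?G1 \<inter> ?G2 = G E" unfolding interval_faces_Int[OF E] G_def .
    have "?G1 \<subseteq> f \<or> ?G2 \<subseteq> f"
      by (rule simple_polytope_facet_contains_one_face[OF Q _ _ _ f(1)])
        (simp_all only: Int G_ne[OF E(1)] \<open>G E \<subseteq> f\<close> face interval_face_face_of not_False_eq_True)
    moreover have "G B \<subseteq> ?G1" "G D \<subseteq> ?G2"
      using that(1,2) endpoints_in_interval_face(2)[of _ k E] unfolding G_def Z_def by auto
    ultimately show False using that(1,2) unfolding Z_def by blast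
  qed
  have "C \<notin> Z" "A \<in> Z" using f A C unfolding Z_def by auto
  moreover have "B = A" if "B \<in> Z" for B
  proof (rule ccontr)
    assume "B \<noteq> A"
    have "C \<in> Z"
      by (rule closed_family_is_everything[of Z k, OF _ closed that \<open>A \<in> Z\<close> \<open>B \<noteq> A\<close> C(1)])
        (auto simp: Z_def)
    then show False using \<open>C \<notin> Z\<close> by blast
  qed
  ultimately have "Z = {A}" by blast
  then show thesis using that f(1) unfolding Z_def G_def by blast
qed

lemma euclidean_simple_extension_facets_ge:
  fixes Q :: "'e::euclidean_space set" and p :: "'e \<Rightarrow> real ^ 'n::finite"
  assumes k: "1 \<le> k" "k < CARD('n)"
    and Q: "simple_polytope Q" and p: "linear p" "p ` Q = hypersimplex k"
  shows "card {A :: 'n set. card A = k} \<le> card (facets Q)"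
proof -
  define missed where "missed F = {B. card B = k \<and> \<not> Q \<inter> p -` {incidence_vector B} \<subseteq> F}" for F
  have "\<exists>f. f facet_of Q \<and> missed f = {A}" if A: "card A = k" for A
  proof -
    have "1 \<le> card A" "card A < CARD('n)" using k A by auto
    then obtain C where C: "card C = card A" "C \<noteq> A" by (rule exists_other_set_same_card)
    have "card C = k" using C A by simp
    obtain f where "f facet_of Q" "missed f = {A}"
      unfolding missed_def
      by (rule simple_extension_facet_missing_one_fibre[OF Q p A \<open>card C = k\<close> C(2)])
    then show ?thesis by blast
  qed
  then have "\<forall>A\<in>{A. card A = k}. \<exists>f. f facet_of Q \<and> missed f = {A}" by simp
  then obtain f where f: "\<forall>A\<in>{A. card A = k}. f A facet_of Q \<and> missed (f A) = {A}"
    using bchoice[of "{A. card A = k}" "\<lambda>A f. f facet_of Q \<and> missed f = {A}"] by blast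
  have "inj_on f {A. card A = k}"
  proof (rule inj_onI)
    fix A B assume "A \<in> {A. card A = k}" "B \<in> {A. card A = k}" "f A = f B"
    then have "{A} = {B}" using f by metis
    then show "A = B" by simp
  qed
  moreover have "f ` {A. card A = k} \<subseteq> facets Q" using f by (auto simp: facets_eq)
  moreover have "finite (facets Q)"
    using Q finite_facets unfolding simple_polytope_def by blast
  ultimately show ?thesis by (rule card_inj_on_le)
qed

text \<open>
  An extension with too few facets would embed into a Euclidean space whose coordinates are the subsets of the index
  set: its span has dimension at most one more than its number of facets, hence at
  most the number of \<open>k\<close>-sets.
\<close>
lemma simple_extension_facets_ge:
  fixes Q :: "'a::real_vector set" and p :: "'a \<Rightarrow> real ^ 'n::finite"
  assumes k: "1 \<le> k" "k < CARD('n)"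
    and Q: "simple_polytope Q" and p: "linear p" "p ` Q = hypersimplex k"
  shows "card {A :: 'n set. card A = k} \<le> card (facets Q)"
proof (rule ccontr)
  assume less: "\<not> card {A :: 'n set. card A = k} \<le> card (facets Q)"
  have poly: "polytope Q" using Q unfolding simple_polytope_def by blast
  obtain A :: "'n set" where "card A = k"
    using obtain_subset_with_card_n[of k "UNIV :: 'n set"] k(2) by auto
  then have "Q \<noteq> {}" using p(2) incidence_vector_in_hypersimplex[of A k] by auto
  obtain C where C: "independent C" "finite C" "Q \<subseteq> span C" "int (card C) \<le> affine_dim Q + 1"
    using polytope_subset_span[OF poly \<open>Q \<noteq> {}\<close>] by blast
  have "card C \<le> card (facets Q) + 1"
    using C(4) simple_polytope_affine_dim_le[OF Q \<open>Q \<noteq> {}\<close>] by linarith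
  also have "\<dots> \<le> card {A :: 'n set. card A = k}" using less by simp
  also have "\<dots> \<le> CARD('n set)" by (intro card_mono) auto
  finally have le: "card C \<le> card (Basis :: (real ^ 'n set) set)" by simp
  obtain f :: "'a \<Rightarrow> real ^ 'n set" and g
    where f: "linear f" and g: "linear g" and inv: "\<And>x. x \<in> span C \<Longrightarrow> g (f x) = x"
    by (rule linear_embedding_of_span[OF C(1,2) independent_Basis finite_Basis le]) blast
  have invQ: "\<And>x. x \<in> Q \<Longrightarrow> g (f x) = x" using inv C(3) by blast
  then have "g ` f ` Q = Q" by force
  then have "(p \<circ> g) ` f ` Q = hypersimplex k" using p(2) image_comp[of p g "f ` Q"] by simp
  then have "card {A :: 'n set. card A = k} \<le> card (facets (f ` Q))"
    using euclidean_simple_extension_facets_ge[OF k] linear_compose[OF g p(1)]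
      simple_polytope_linear_image(1)[OF f g invQ Q] by blast
  then show False using less simple_polytope_linear_image(2)[OF f g invQ Q] by simp
qed

section \<open>The upper bound\<close>

text \<open>
  Two points are needed: the only facet candidate of a single point is empty.
\<close>
lemma simple_polytope_simplex:
  fixes S :: "'a::euclidean_space set"
  assumes S: "\<not> affine_dependent S" and "2 \<le> card S"
  shows "simple_polytope (convex hull S)" and "card (facets (convex hull S)) = card S"
proof -
  have fin: "finite S" using assms(2) by (rule card_ge_0_finite[OF less_le_trans[rotated]]) simp
  let ?F = "\<lambda>u. convex hull (S - {u})"
  have notin: "v \<in> ?F u \<longleftrightarrow> v \<noteq> u" if "v \<in> S" for u v
  proof
    show "v \<noteq> u" if "v \<in> ?F u"
      using that \<open>v \<in> S\<close> S convex_hull_subset_affine_hull[of "S - {u}"]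
      unfolding affine_dependent_def by blast
  qed (use that in \<open>simp add: hull_inc\<close>)
  have "S - {u} \<noteq> {}" for u
  proof
    assume "S - {u} = {}"
    then have "card S \<le> card {u}" by (intro card_mono) auto
    then show False using assms(2) by simp
  qed
  then have fac: "facets (convex hull S) = ?F ` S"
    by (auto simp: facets_eq facet_of_convex_hull_affine_independent[OF S])
  have inj: "inj_on ?F S"
  proof (rule inj_onI)
    fix u v assume "u \<in> S" "v \<in> S" "?F u = ?F v"
    then show "u = v" using notin[of u u] notin[of u v] by simp
  qed
  show "card (facets (convex hull S)) = card S" unfolding fac using inj by (rule card_image)
  have "int (card {F \<in> facets (convex hull S). v \<in> F}) = affine_dim (convex hull S)"
    if "v extreme_point_of convex hull S" for v
  proof -
    have v: "v \<in> S" using that by (rule extreme_point_of_convex_hull)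
    have "{F \<in> facets (convex hull S). v \<in> F} = ?F ` (S - {v})"
      unfolding fac using notin[OF v] by auto
    then have "card {F \<in> facets (convex hull S). v \<in> F} = card (S - {v})"
      using card_image[OF inj_on_subset[OF inj]] by (metis Diff_subset)
    also have "\<dots> = card S - 1" using v by simp
    finally have "int (card {F \<in> facets (convex hull S). v \<in> F}) = int (card S) - 1"
      using assms(2) by simp
    then show ?thesis
      using aff_dim_affine_independent[OF S] by (simp add: affine_dim_eq_aff_dim aff_dim_convex_hull)
  qed
  then show "simple_polytope (convex hull S)"
    unfolding simple_polytope_def using polytope_convex_hull[OF fin] by blast
qed

lemma lookup_scaleR:
  fixes x :: "'a \<Rightarrow>\<^sub>0 real"
  shows "Poly_Mapping.lookup (c *\<^sub>R x) i = c * Poly_Mapping.lookup x i"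
proof -
  have "finite {i. c *\<^sub>R Poly_Mapping.lookup x i \<noteq> 0}"
    by (rule finite_subset[OF _ finite_keys[of x]]) (auto simp: in_keys_iff)
  then show ?thesis by (simp add: scaleR_poly_mapping_def Abs_poly_mapping_inverse)
qed

lemma subspace_Rspace: "subspace (Rspace m)"
proof (rule subspaceI)
  show "x + y \<in> Rspace m" if "x \<in> Rspace m" "y \<in> Rspace m" for x y
    using that keys_add[of x y] unfolding Rspace_def by blast
  show "c *\<^sub>R x \<in> Rspace m" if "x \<in> Rspace m" for c x
  proof -
    have "Poly_Mapping.keys (c *\<^sub>R x) \<subseteq> Poly_Mapping.keys x"
      by (auto simp: in_keys_iff lookup_scaleR)
    then show ?thesis using that unfolding Rspace_def by blast
  qed
qed (simp add: Rspace_def)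

lemma independent_unit_sequences:
  "independent ((\<lambda>i. Poly_Mapping.single i (1::real)) ` {..<m::nat})"
  (is "independent ?B")
proof -
  let ?e = "\<lambda>i. Poly_Mapping.single i (1::real)"
  have "?e i \<notin> span (?B - {?e i})" for i
  proof
    let ?V = "{x. Poly_Mapping.lookup x i = (0::real)}"
    have "subspace ?V"
      by (rule subspaceI) (auto simp: lookup_add lookup_scaleR)
    moreover have "?B - {?e i} \<subseteq> ?V" by (auto simp: lookup_single when_def)
    ultimately have "span (?B - {?e i}) \<subseteq> ?V" by (rule span_minimal[rotated])
    moreover assume "?e i \<in> span (?B - {?e i})"
    ultimately show False by auto
  qed
  then show ?thesis unfolding dependent_def by auto
qed

text \<open>
  The simplex is spanned by the unit vectors of \<open>\<real>\<close> to the power set that belong to \<open>k\<close>-sets, and \<open>M\<close> sends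
  each of them to the corresponding vertex. By the Krein--Milman theorem the image is the whole hypersimplex.
\<close>
lemma hypersimplex_simple_extension_by_simplex:
  assumes k: "1 \<le> k" "k < CARD('n::finite)"
  obtains m and Q :: "(nat \<Rightarrow>\<^sub>0 real) set" and p :: "(nat \<Rightarrow>\<^sub>0 real) \<Rightarrow> real ^ 'n"
  where "Q \<subseteq> Rspace m" "simple_polytope Q" "extension Q p (hypersimplex k)"
    "card (facets Q) = card {A :: 'n set. card A = k}"
proof -
  define S :: "(real ^ 'n set) set" where "S = (\<lambda>A. axis A 1) ` {A. card A = k}"
  have inj: "inj_on (\<lambda>A. axis A (1::real) :: real ^ 'n set) X" for X
    by (rule inj_onI) (simp add: axis_eq_axis)
  have cardS: "card S = card {A :: 'n set. card A = k}"
    unfolding S_def using inj by (rule card_image)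
  obtain A :: "'n set" where A: "card A = k"
    using obtain_subset_with_card_n[of k "UNIV :: 'n set"] k(2) by auto
  have "1 \<le> card A" "card A < CARD('n)" using k A by auto
  then obtain C where "card C = card A" "C \<noteq> A" by (rule exists_other_set_same_card)
  then have C: "card C = k" "C \<noteq> A" using A by auto
  have "card {A, C} \<le> card S" unfolding cardS using A C by (intro card_mono) auto
  then have card2: "2 \<le> card S" using C(2) by simp
  have "S \<subseteq> Basis" unfolding S_def by (auto simp: Basis_vec_def)
  then have "independent S" using independent_Basis independent_mono by blast
  then have indep: "\<not> affine_dependent S" using affine_dependent_imp_dependent by blast

  define M :: "real ^ 'n set \<Rightarrow> real ^ 'n" where "M x = (\<Sum>A\<in>UNIV. x $ A *\<^sub>R incidence_vector A)" for x
  have linM: "linear M"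
    by (rule linearI) (simp_all add: M_def scaleR_left_distrib sum.distrib scaleR_sum_right)
  have "M (axis A 1) = incidence_vector A" for A
  proof -
    have "M (axis A 1) = (\<Sum>B\<in>UNIV. if B = A then incidence_vector A else 0)"
      unfolding M_def by (rule sum.cong) (auto simp: axis_def)
    then show ?thesis by simp
  qed
  then have "M ` S = {x. x extreme_point_of hypersimplex k}"
    unfolding S_def extreme_points_hypersimplex by (simp add: image_image)
  then have MS: "M ` (convex hull S) = hypersimplex k"
    using convex_hull_linear_image[OF linM, of S]
      Krein_Milman_Minkowski[OF compact_hypersimplex convex_hypersimplex, of k, symmetric] by simp

  \<comment> \<open>transfer of the simplex to sequences\<close>
  let ?m = "CARD('n set)"
  let ?E = "(\<lambda>i. Poly_Mapping.single i (1::real)) ` {..<?m}"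
  have "inj_on (\<lambda>i. Poly_Mapping.single i (1::real)) {..<?m}"
    by (rule inj_onI) (metis lookup_single_eq lookup_single_not_eq zero_neq_one)
  then have "card ?E = ?m" using card_image by fastforce
  then have le: "card (Basis :: (real ^ 'n set) set) \<le> card ?E" by simp
  obtain f :: "real ^ 'n set \<Rightarrow> nat \<Rightarrow>\<^sub>0 real" and g
    where f: "linear f" and g: "linear g"
      and inv: "\<And>x. x \<in> span (Basis :: (real ^ 'n set) set) \<Longrightarrow> g (f x) = x"
      and im: "f ` span (Basis :: (real ^ 'n set) set) \<subseteq> span ?E"
    by (rule linear_embedding_of_span[OF independent_Basis finite_Basis
        independent_unit_sequences[of ?m] finite_imageI[OF finite_lessThan] le]) blast
  have inv': "\<And>x. x \<in> convex hull S \<Longrightarrow> g (f x) = x" using inv by simp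
  have "?E \<subseteq> Rspace ?m" by (auto simp: Rspace_def)
  then have "span ?E \<subseteq> Rspace ?m" using subspace_Rspace by (rule span_minimal)
  then have sub: "f ` (convex hull S) \<subseteq> Rspace ?m" using im by (auto simp: image_subset_iff)
  note simple = simple_polytope_linear_image[OF f g inv' simple_polytope_simplex(1)[OF indep card2]]
  have "g ` f ` (convex hull S) = convex hull S" using inv' by force
  then have "(M \<circ> g) ` f ` (convex hull S) = hypersimplex k"
    using MS image_comp[of M g "f ` (convex hull S)"] by simp
  then have "extension (f ` (convex hull S)) (M \<circ> g) (hypersimplex k)"
    using simple(1) linear_compose[OF g linM] unfolding extension_def simple_polytope_def by blast
  then show thesis
    using that[OF sub simple(1)] simple(2) simple_polytope_simplex(2)[OF indep card2] cardS by simp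
qed

section \<open>The simple extension complexity of hypersimplices\<close>

theorem theorem4p1:
  fixes k :: nat
  assumes "1 \<le> k" and "k \<le> CARD('n::finite) - 1"
  shows "sxc (hypersimplex k :: (real ^ 'n) set)
           = card {v. v extreme_point_of (hypersimplex k :: (real ^ 'n) set)}
       \<and> card {v. v extreme_point_of (hypersimplex k :: (real ^ 'n) set)} = CARD('n) choose k"
proof
  have k: "1 \<le> k" "k < CARD('n)" using assms by auto
  show card: "card {v. v extreme_point_of (hypersimplex k :: (real ^ 'n) set)} = CARD('n) choose k"
    by (rule card_extreme_points_hypersimplex)
  have N: "card {A :: 'n set. card A = k} = CARD('n) choose k"
    using n_subsets[of "UNIV :: 'n set" k] by simp
  have "sxc (hypersimplex k :: (real ^ 'n) set) = card {A :: 'n set. card A = k}"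
    unfolding sxc_def
  proof (rule Least_equality)
    show "\<exists>m Q \<pi>. Q \<subseteq> Rspace m \<and> simple_polytope Q
      \<and> extension Q \<pi> (hypersimplex k :: (real ^ 'n) set)
      \<and> card (facets Q) = card {A :: 'n set. card A = k}"
      using hypersimplex_simple_extension_by_simplex[OF k] by metis
  next
    fix s assume "\<exists>m Q \<pi>. Q \<subseteq> Rspace m \<and> simple_polytope Q
      \<and> extension Q \<pi> (hypersimplex k :: (real ^ 'n) set) \<and> card (facets Q) = s"
    then show "card {A :: 'n set. card A = k} \<le> s"
      unfolding extension_def using simple_extension_facets_ge[OF k] by blast
  qed
  then show "sxc (hypersimplex k :: (real ^ 'n) set)
      = card {v. v extreme_point_of (hypersimplex k :: (real ^ 'n) set)}"
    using card N by simp
qed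

end
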